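(* The following hold. (i) Let $(P,\leq,{}^*,0)$ be a Stone poset and let $\mathbf A=(P,\sqcup,\sqcap,{}^*,0)$, where $(P,\sqcup,\sqcap)$ is a $\lambda$-lattice assigned to $(P,\leq)$. Then $\mathbf A$ is congruence distributive. (ii) Let $(P,\leq,*,1)$ be a down-directed relatively pseudocomplemented poset and let $\mathbf A=(P,\sqcap,*,1)$, where $(P,\sqcap)$ is a commutative meet-directoid assigned to $(P,\leq)$. Then $\mathbf A$ is congruence permutable and weakly regular (with respect to $1$). (iii) Let $(P,\leq,\circ)$ be a directed sectionally pseudocomplemented poset and let $\mathbf A=(P,\sqcup,\sqcap,\circ)$, where $(P,\sqcup,\sqcap)$ is a $\lambda$-lattice assigned to $(P,\leq)$. Then $\mathbf A$ is congruence distributive. (iv) Let $(P,\leq,\circ,1)$ be a down-directed sectionally pseudocomplemented poset with $1$ and let $\mathbf A=(P,\sqcup,\sqcap,\circ,1)$, where $(P,\sqcup,\sqcap)$ is a $\lambda$-lattice assigned to $(P,\leq)$. Then $\mathbf A$ is congruence distributive and weakly regular (with respect to $1$). (v) Let $(P,\leq,\circ,1)$ be a down-directed strongly sectionally pseudocomplemented poset and let $\mathbf A=(P,\sqcup,\sqcap,\circ,1)$, where $(P,\sqcup,\sqcap)$ is a $\lambda$-lattice assigned to $(P,\leq)$. Then $\mathbf A$ is arithmetical and weakly regular (with respect to $1$).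
   Context: For a poset $(P,\leq)$ and $A\subseteq P$ let $L(A)=\{x\in P\mid x\leq a\text{ for all }a\in A\}$ and $U(A)=\{x\in P\mid a\leq x\text{ for all }a\in A\}$. Write $L(a)=L(\{a\})$, $L(a,b)=L(\{a,b\})$, $L(A,b)=L(A\cup\{b\})$, and similarly for $U$. The poset is down-directed if $L(x,y)\neq\emptyset$ for all $x,y\in P$, up-directed if $U(x,y)\neq\emptyset$ for all $x,y\in P$, and directed if it is both. (A poset with a top element is up-directed, one with a bottom element is down-directed.) A commutative meet-directoid assigned to a down-directed poset $(P,\leq)$ is a groupoid $(P,\sqcap)$ such that for all $x,y\in P$: $x\sqcap y=y\sqcap x\in L(x,y)$, and $x\sqcap y=\min(x,y)$ whenever $x$ and $y$ are comparable (otherwise it is an arbitrarily chosen element of $L(x,y)$). A $\lambda$-lattice assigned to a directed poset $(P,\leq)$ is an algebra $(P,\sqcup,\sqcap)$ with two binary operations such that for all $x,y\in P$: $x\sqcup y=y\sqcup x\in U(x,y)$ and $x\sqcap y=y\sqcap x\in L(x,y)$, and $x\sqcup y=\max(x,y)$, $x\sqcap y=\min(x,y)$ whenever $x$ and $y$ are comparable (otherwise these are arbitrarily chosen elements of $U(x,y)$ and $L(x,y)$, respectively). A pseudocomplemented poset is a quadruple $(P,\leq,{}^*,0)$ such that $(P,\leq)$ is a poset with bottom element $0$ and ${}^*$ is a unary operation on $P$ such that for every $x\in P$, $x^*$ is the greatest element $y$ of $P$ satisfying $L(x,y)=\{0\}$; then $0^*$ is the top element. A Stone poset is a pseudocomplemented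 poset satisfying $U(x^*,x^{**})=\{0^*\}$ for all $x\in P$. A relatively pseudocomplemented poset is a quadruple $(P,\leq,*,1)$ such that $(P,\leq)$ is a poset with top element $1$ and $*$ is a binary operation on $P$ such that for all $x,y\in P$, $x*y$ is the greatest element $z$ of $P$ satisfying $L(x,z)\subseteq L(y)$. A sectionally pseudocomplemented poset is a triple $(P,\leq,\circ)$ such that $(P,\leq)$ is a poset and $\circ$ is a binary operation on $P$ such that for all $x,y\in P$, $x\circ y$ is the greatest element $z$ of $P$ satisfying $L(U(x,y),z)=L(y)$. A sectionally pseudocomplemented poset with $1$ is a quadruple $(P,\leq,\circ,1)$ such that $(P,\leq,\circ)$ is a sectionally pseudocomplemented poset and $1$ is the top element of $(P,\leq)$. A strongly sectionally pseudocomplemented poset is a sectionally pseudocomplemented poset $(P,\leq,\circ,1)$ with $1$ satisfying $x\leq(x\circ y)\circ y$ for all $x,y\in P$. Let $\mathrm{Con}\,\mathbf A$ be the set (lattice) of congruences of an algebra $\mathbf A$. $\mathbf A$ is congruence permutable if $\Theta\circ\Phi=\Phi\circ\Theta$ (relational product) for all $\Theta,\Phi\in\mathrm{Con}\,\mathbf A$; congruence distributive if the lattice $\mathrm{Con}\,\mathbf A$ is distributive; arithmetical if it is both congruence permutable and congruence distributive; weakly regular with respect to a constant $1$ if $\Theta,\Phi\in\mathrm{Con}\,\mathbf A$ and $[1]\Theta=[1]\Phi$ imply $\Theta=\Phi$, where $[1]\Theta$ denotes the $\Theta$-class of $1$. *)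

theory Defs
  imports "HOL-Algebra.Lattice"
begin

text \<open>
  A poset is a structure \<open>P\<close> with \<open>partial_order P\<close>; the sets \<open>L(A)\<close> and \<open>U(A)\<close> of lower and
  upper bounds are \<open>Lower P A\<close> and \<open>Upper P A\<close>. Operations are total HOL functions of which only
  the values on the carrier matter.
\<close>

subsection \<open>Directed posets and the operations assigned to them\<close>

definition down_directed :: "('a, 'b) gorder_scheme \<Rightarrow> bool" where
  "down_directed P \<longleftrightarrow> (\<forall>x\<in>carrier P. \<forall>y\<in>carrier P. Lower P {x, y} \<noteq> {})"

definition up_directed :: "('a, 'b) gorder_scheme \<Rightarrow> bool" where
  "up_directed P \<longleftrightarrow> (\<forall>x\<in>carrier P. \<forall>y\<in>carrier P. Upper P {x, y} \<noteq> {})"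

definition directed :: "('a, 'b) gorder_scheme \<Rightarrow> bool" where
  "directed P \<longleftrightarrow> down_directed P \<and> up_directed P"

text \<open>
  Closure of the carrier under \<open>cap\<close> and \<open>cup\<close> is contained in the membership conditions, since
  \<open>Lower P A\<close> and \<open>Upper P A\<close> are subsets of the carrier.
\<close>

definition commutative_meet_directoid ::
    "('a, 'b) gorder_scheme \<Rightarrow> ('a \<Rightarrow> 'a \<Rightarrow> 'a) \<Rightarrow> bool" where
  "commutative_meet_directoid P cap \<longleftrightarrow>
     (\<forall>x\<in>carrier P. \<forall>y\<in>carrier P.
        cap x y = cap y x \<and> cap x y \<in> Lower P {x, y} \<and>
        (x \<sqsubseteq>\<^bsub>P\<^esub> y \<longrightarrow> cap x y = x) \<and> (y \<sqsubseteq>\<^bsub>P\<^esub> x \<longrightarrow> cap x y = y))"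

definition lambda_lattice ::
    "('a, 'b) gorder_scheme \<Rightarrow> ('a \<Rightarrow> 'a \<Rightarrow> 'a) \<Rightarrow> ('a \<Rightarrow> 'a \<Rightarrow> 'a) \<Rightarrow> bool" where
  "lambda_lattice P cup cap \<longleftrightarrow>
     (\<forall>x\<in>carrier P. \<forall>y\<in>carrier P.
        cup x y = cup y x \<and> cup x y \<in> Upper P {x, y} \<and>
        cap x y = cap y x \<and> cap x y \<in> Lower P {x, y} \<and>
        (x \<sqsubseteq>\<^bsub>P\<^esub> y \<longrightarrow> cup x y = y \<and> cap x y = x) \<and>
        (y \<sqsubseteq>\<^bsub>P\<^esub> x \<longrightarrow> cup x y = x \<and> cap x y = y))"

subsection \<open>Pseudocomplementation in posets\<close>

definition pseudocomplemented_poset ::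
    "('a, 'b) gorder_scheme \<Rightarrow> ('a \<Rightarrow> 'a) \<Rightarrow> 'a \<Rightarrow> bool" where
  "pseudocomplemented_poset P star zero \<longleftrightarrow>
     partial_order P \<and> least P zero (carrier P) \<and>
     (\<forall>x\<in>carrier P. greatest P (star x) {y \<in> carrier P. Lower P {x, y} = {zero}})"

definition stone_poset :: "('a, 'b) gorder_scheme \<Rightarrow> ('a \<Rightarrow> 'a) \<Rightarrow> 'a \<Rightarrow> bool" where
  "stone_poset P star zero \<longleftrightarrow>
     pseudocomplemented_poset P star zero \<and>
     (\<forall>x\<in>carrier P. Upper P {star x, star (star x)} = {star zero})"

definition relatively_pseudocomplemented_poset ::
    "('a, 'b) gorder_scheme \<Rightarrow> ('a \<Rightarrow> 'a \<Rightarrow> 'a) \<Rightarrow> 'a \<Rightarrow> bool" where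
  "relatively_pseudocomplemented_poset P rpc one \<longleftrightarrow>
     partial_order P \<and> greatest P one (carrier P) \<and>
     (\<forall>x\<in>carrier P. \<forall>y\<in>carrier P.
        greatest P (rpc x y) {z \<in> carrier P. Lower P {x, z} \<subseteq> Lower P {y}})"

definition sectionally_pseudocomplemented_poset ::
    "('a, 'b) gorder_scheme \<Rightarrow> ('a \<Rightarrow> 'a \<Rightarrow> 'a) \<Rightarrow> bool" where
  "sectionally_pseudocomplemented_poset P spc \<longleftrightarrow>
     partial_order P \<and>
     (\<forall>x\<in>carrier P. \<forall>y\<in>carrier P.
        greatest P (spc x y) {z \<in> carrier P. Lower P (Upper P {x, y} \<union> {z}) = Lower P {y}})"

definition sectionally_pseudocomplemented_poset_with_one ::
    "('a, 'b) gorder_scheme \<Rightarrow> ('a \<Rightarrow> 'a \<Rightarrow> 'a) \<Rightarrow> 'a \<Rightarrow> bool" where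
  "sectionally_pseudocomplemented_poset_with_one P spc one \<longleftrightarrow>
     sectionally_pseudocomplemented_poset P spc \<and> greatest P one (carrier P)"

definition strongly_sectionally_pseudocomplemented_poset ::
    "('a, 'b) gorder_scheme \<Rightarrow> ('a \<Rightarrow> 'a \<Rightarrow> 'a) \<Rightarrow> 'a \<Rightarrow> bool" where
  "strongly_sectionally_pseudocomplemented_poset P spc one \<longleftrightarrow>
     sectionally_pseudocomplemented_poset_with_one P spc one \<and>
     (\<forall>x\<in>carrier P. \<forall>y\<in>carrier P. x \<sqsubseteq>\<^bsub>P\<^esub> spc (spc x y) y)"

subsection \<open>Algebras and their congruences\<close>

datatype 'a operation =
    Nullary 'a
  | Unary "'a \<Rightarrow> 'a"
  | Binary "'a \<Rightarrow> 'a \<Rightarrow> 'a"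

record 'a universal_algebra = "'a partial_object" +
  operations :: "'a operation set"

fun compatible :: "'a rel \<Rightarrow> 'a operation \<Rightarrow> bool" where
  "compatible \<Theta> (Nullary c) \<longleftrightarrow> (c, c) \<in> \<Theta>"
| "compatible \<Theta> (Unary f) \<longleftrightarrow> (\<forall>x y. (x, y) \<in> \<Theta> \<longrightarrow> (f x, f y) \<in> \<Theta>)"
| "compatible \<Theta> (Binary f) \<longleftrightarrow>
     (\<forall>x y u v. (x, y) \<in> \<Theta> \<longrightarrow> (u, v) \<in> \<Theta> \<longrightarrow> (f x u, f y v) \<in> \<Theta>)"

definition Con :: "('a, 'b) universal_algebra_scheme \<Rightarrow> 'a rel set" where
  "Con A = {\<Theta>. equiv (carrier A) \<Theta> \<and> (\<forall>f\<in>operations A. compatible \<Theta> f)}"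

definition Con_lattice :: "('a, 'b) universal_algebra_scheme \<Rightarrow> 'a rel gorder" where
  "Con_lattice A = \<lparr>carrier = Con A, eq = (=), le = (\<subseteq>)\<rparr>"

definition distributive_lattice :: "('a, 'b) gorder_scheme \<Rightarrow> bool" where
  "distributive_lattice L \<longleftrightarrow>
     lattice L \<and>
     (\<forall>x\<in>carrier L. \<forall>y\<in>carrier L. \<forall>z\<in>carrier L.
        x \<sqinter>\<^bsub>L\<^esub> (y \<squnion>\<^bsub>L\<^esub> z) = (x \<sqinter>\<^bsub>L\<^esub> y) \<squnion>\<^bsub>L\<^esub> (x \<sqinter>\<^bsub>L\<^esub> z))"

definition congruence_permutable :: "('a, 'b) universal_algebra_scheme \<Rightarrow> bool" where
  "congruence_permutable A \<longleftrightarrow> (\<forall>\<Theta>\<in>Con A. \<forall>\<Phi>\<in>Con A. \<Theta> O \<Phi> = \<Phi> O \<Theta>)"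

definition congruence_distributive :: "('a, 'b) universal_algebra_scheme \<Rightarrow> bool" where
  "congruence_distributive A \<longleftrightarrow> distributive_lattice (Con_lattice A)"

definition arithmetical :: "('a, 'b) universal_algebra_scheme \<Rightarrow> bool" where
  "arithmetical A \<longleftrightarrow> congruence_permutable A \<and> congruence_distributive A"

definition weakly_regular :: "('a, 'b) universal_algebra_scheme \<Rightarrow> 'a \<Rightarrow> bool" where
  "weakly_regular A one \<longleftrightarrow>
     (\<forall>\<Theta>\<in>Con A. \<forall>\<Phi>\<in>Con A. \<Theta> `` {one} = \<Phi> `` {one} \<longrightarrow> \<Theta> = \<Phi>)"

end

theory Submission
  imports Defs
begin

text \<open>
  Each of the claimed congruence properties is governed by terms satisfying suitable identities,
  and the orders at hand are just strong enough to supply such terms.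

  A \<open>\<lambda>\<close>-lattice need be neither associative nor monotone, but it satisfies the absorption laws.
  Therefore the lattice term \<open>((x \<sqinter> y) \<squnion> (y \<sqinter> z)) \<squnion> (z \<sqinter> x)\<close> is still a majority term, and
  every algebra having one is congruence distributive.

  If \<open>x \<cdot> x = 1\<close>, \<open>1 \<cdot> x = x\<close> and \<open>x \<sqsubseteq> (x \<cdot> y) \<cdot> y\<close>, then
  \<open>((x \<cdot> y) \<cdot> z) \<sqinter> ((z \<cdot> y) \<cdot> x)\<close> is a Mal'cev term: putting \<open>x = y\<close> turns it into the meet
  of \<open>z\<close> with the larger element \<open>(z \<cdot> x) \<cdot> x\<close>, and putting \<open>y = z\<close> is symmetric. A relative
  pseudocomplementation always satisfies these laws, a sectional one with \<open>1\<close> satisfies them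
  exactly when it is strong.

  For weak regularity, a congruence must be recoverable from its class of \<open>1\<close>. With relative
  pseudocomplements, the inequality
  \<open>x \<sqsubseteq> (x * y) * y\<close> makes \<open>x\<close> and \<open>y\<close> congruent as soon as both \<open>x * y\<close> and \<open>y * x\<close> are
  congruent to \<open>1\<close>. For sectional pseudocomplements in general,
  the inequality \<open>x \<sqsubseteq> (x \<circ> y) \<circ> y\<close> is not granted. There the terms \<open>(x \<squnion> y) \<circ> y\<close> and \<open>(x \<squnion> y) \<circ> x\<close>
  are used instead, since \<open>w \<circ> y\<close> and \<open>w\<close> have only lower bounds of \<open>y\<close> in common
  whenever \<open>y \<sqsubseteq> w\<close>.
\<close>

section \<open>Congruences and their joins\<close>

lemma Con_equiv: "\<Theta> \<in> Con A \<Longrightarrow> equiv (carrier A) \<Theta>"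
  by (simp add: Con_def)

lemma Con_carrier:
  assumes "\<Theta> \<in> Con A" "(x, y) \<in> \<Theta>"
  shows "x \<in> carrier A" "y \<in> carrier A"
  using equiv_type[OF Con_equiv[OF assms(1)]] assms(2) by auto

lemma Con_refl: "\<Theta> \<in> Con A \<Longrightarrow> x \<in> carrier A \<Longrightarrow> (x, x) \<in> \<Theta>"
  using Con_equiv[of \<Theta> A] by (auto simp: equiv_def refl_on_def)

lemma Con_sym: "\<Theta> \<in> Con A \<Longrightarrow> (x, y) \<in> \<Theta> \<Longrightarrow> (y, x) \<in> \<Theta>"
  using Con_equiv[of \<Theta> A] by (auto simp: equiv_def dest: symD)

lemma Con_trans: "\<Theta> \<in> Con A \<Longrightarrow> (x, y) \<in> \<Theta> \<Longrightarrow> (y, z) \<in> \<Theta> \<Longrightarrow> (x, z) \<in> \<Theta>"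
  using Con_equiv[of \<Theta> A] by (auto simp: equiv_def dest: transD)

lemma Con_Binary:
  "\<Theta> \<in> Con A \<Longrightarrow> Binary f \<in> operations A \<Longrightarrow> (x, y) \<in> \<Theta> \<Longrightarrow> (u, v) \<in> \<Theta> \<Longrightarrow> (f x u, f y v) \<in> \<Theta>"
  by (auto simp: Con_def)

lemma compatible_Int: "compatible \<Theta> f \<Longrightarrow> compatible \<Phi> f \<Longrightarrow> compatible (\<Theta> \<inter> \<Phi>) f"
  by (cases f) auto

lemma Con_Int:
  assumes "\<Theta> \<in> Con A" "\<Phi> \<in> Con A"
  shows "\<Theta> \<inter> \<Phi> \<in> Con A"
  using assms
  by (auto simp: Con_def equiv_def refl_on_def intro: sym_Int trans_Int compatible_Int)

lemma trancl_homomorphism: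
  assumes chain: "(x, y) \<in> R\<^sup>+" and hom: "\<And>x y. (x, y) \<in> R \<Longrightarrow> (h x, h y) \<in> S"
  shows "(h x, h y) \<in> S\<^sup>+"
  using chain
proof induction
  case (base y)
  then show ?case by (intro r_into_trancl hom)
next
  case (step y z)
  show ?case by (rule trancl_into_trancl[OF step.IH hom[OF step.hyps(2)]])
qed

text \<open>
  For a binary operation, a chain for the first argument and one for the second are run through
  one after the other, the argument at rest being related to itself.
\<close>

lemma compatible_trancl_Un:
  assumes \<Theta>: "\<Theta> \<in> Con A" and \<Phi>: "\<Phi> \<in> Con A" and f: "f \<in> operations A"
  shows "compatible ((\<Theta> \<union> \<Phi>)\<^sup>+) f"
proof (cases f)
  case (Nullary c)
  have "compatible \<Theta> f" using \<Theta> f by (simp add: Con_def)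
  then show ?thesis using Nullary by auto
next
  case (Unary g)
  have step: "(g x, g y) \<in> \<Theta> \<union> \<Phi>" if "(x, y) \<in> \<Theta> \<union> \<Phi>" for x y
    using that \<Theta> \<Phi> f Unary by (fastforce simp: Con_def)
  have "(g x, g y) \<in> (\<Theta> \<union> \<Phi>)\<^sup>+" if "(x, y) \<in> (\<Theta> \<union> \<Phi>)\<^sup>+" for x y
    using that step by (rule trancl_homomorphism)
  then show ?thesis using Unary by simp
next
  case (Binary g)
  have step: "(g x u, g y v) \<in> \<Theta> \<union> \<Phi>"
    if "(x, y) \<in> \<Theta> \<and> (u, v) \<in> \<Theta> \<or> (x, y) \<in> \<Phi> \<and> (u, v) \<in> \<Phi>" for x y u v
    using that Con_Binary[OF \<Theta>] Con_Binary[OF \<Phi>] f Binary by blast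
  have carr: "x \<in> carrier A" "y \<in> carrier A" if "(x, y) \<in> (\<Theta> \<union> \<Phi>)\<^sup>+" for x y
    using that by (induction, auto dest: Con_carrier[OF \<Theta>] Con_carrier[OF \<Phi>])
  have left: "(g x u, g y u) \<in> (\<Theta> \<union> \<Phi>)\<^sup>+" if "(x, y) \<in> (\<Theta> \<union> \<Phi>)\<^sup>+" "u \<in> carrier A" for x y u
  proof -
    have "(g x u, g y u) \<in> \<Theta> \<union> \<Phi>" if "(x, y) \<in> \<Theta> \<union> \<Phi>" for x y
      using that step Con_refl[OF \<Theta> \<open>u \<in> carrier A\<close>] Con_refl[OF \<Phi> \<open>u \<in> carrier A\<close>] by blast
    with that(1) show ?thesis by (rule trancl_homomorphism)
  qed
  have right: "(g y u, g y v) \<in> (\<Theta> \<union> \<Phi>)\<^sup>+" if "(u, v) \<in> (\<Theta> \<union> \<Phi>)\<^sup>+" "y \<in> carrier A" for y u v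
  proof -
    have "(g y u, g y v) \<in> \<Theta> \<union> \<Phi>" if "(u, v) \<in> \<Theta> \<union> \<Phi>" for u v
      using that step Con_refl[OF \<Theta> \<open>y \<in> carrier A\<close>] Con_refl[OF \<Phi> \<open>y \<in> carrier A\<close>] by blast
    with that(1) show ?thesis by (rule trancl_homomorphism)
  qed
  have "(g x u, g y v) \<in> (\<Theta> \<union> \<Phi>)\<^sup>+"
    if "(x, y) \<in> (\<Theta> \<union> \<Phi>)\<^sup>+" "(u, v) \<in> (\<Theta> \<union> \<Phi>)\<^sup>+" for x y u v
    using left[OF that(1) carr(1)[OF that(2)]] right[OF that(2) carr(2)[OF that(1)]]
    by (rule trancl_trans)
  then show ?thesis using Binary by simp
qed

lemma Con_trancl_Un:
  assumes \<Theta>: "\<Theta> \<in> Con A" and \<Phi>: "\<Phi> \<in> Con A"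
  shows "(\<Theta> \<union> \<Phi>)\<^sup>+ \<in> Con A"
proof -
  have "equiv (carrier A) ((\<Theta> \<union> \<Phi>)\<^sup>+)"
  proof (rule equivI)
    show "(\<Theta> \<union> \<Phi>)\<^sup>+ \<subseteq> carrier A \<times> carrier A"
      using equiv_type[OF Con_equiv[OF \<Theta>]] equiv_type[OF Con_equiv[OF \<Phi>]]
      by (intro trancl_subset_Sigma) auto
    show "refl_on (carrier A) ((\<Theta> \<union> \<Phi>)\<^sup>+)"
      by (auto simp: refl_on_def intro: Con_refl[OF \<Theta>])
    show "sym ((\<Theta> \<union> \<Phi>)\<^sup>+)"
      by (intro sym_trancl sym_Un symI) (auto intro: Con_sym[OF \<Theta>] Con_sym[OF \<Phi>])
  qed (rule trans_trancl)
  with compatible_trancl_Un[OF assms] show ?thesis by (simp add: Con_def)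
qed

lemma trancl_Un_le_Con:
  assumes "\<Psi> \<in> Con A" "\<Theta> \<subseteq> \<Psi>" "\<Phi> \<subseteq> \<Psi>"
  shows "(\<Theta> \<union> \<Phi>)\<^sup>+ \<subseteq> \<Psi>"
proof -
  have "(\<Theta> \<union> \<Phi>)\<^sup>+ \<subseteq> \<Psi>\<^sup>+" using assms(2,3) by (intro trancl_mono_subset) auto
  also have "\<Psi>\<^sup>+ = \<Psi>" using Con_equiv[OF assms(1)] by (simp add: equiv_def trancl_id)
  finally show ?thesis .
qed

lemma carrier_Con_lattice: "carrier (Con_lattice A) = Con A"
  by (simp add: Con_lattice_def)

lemma greatest_Int_Con_lattice:
  "\<Theta> \<in> Con A \<Longrightarrow> \<Phi> \<in> Con A \<Longrightarrow> greatest (Con_lattice A) (\<Theta> \<inter> \<Phi>) (Lower (Con_lattice A) {\<Theta>, \<Phi>})"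
  using Con_Int[of \<Theta> A \<Phi>] by (auto simp: greatest_def Lower_def Con_lattice_def)

lemma least_trancl_Un_Con_lattice:
  assumes "\<Theta> \<in> Con A" "\<Phi> \<in> Con A"
  shows "least (Con_lattice A) ((\<Theta> \<union> \<Phi>)\<^sup>+) (Upper (Con_lattice A) {\<Theta>, \<Phi>})"
proof -
  have "\<Theta> \<subseteq> (\<Theta> \<union> \<Phi>)\<^sup>+" "\<Phi> \<subseteq> (\<Theta> \<union> \<Phi>)\<^sup>+" by auto
  then show ?thesis
    using Con_trancl_Un[OF assms] assms trancl_Un_le_Con[where A = A]
    by (simp add: least_def Upper_def Con_lattice_def)
qed

lemma lattice_Con_lattice: "lattice (Con_lattice A)"
proof -
  interpret partial_order "Con_lattice A"
    by unfold_locales (auto simp: Con_lattice_def)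
  show ?thesis
    by unfold_locales
      (metis carrier_Con_lattice least_trancl_Un_Con_lattice,
       metis carrier_Con_lattice greatest_Int_Con_lattice)
qed

lemma meet_Con_lattice:
  assumes "\<Theta> \<in> Con A" "\<Phi> \<in> Con A"
  shows "\<Theta> \<sqinter>\<^bsub>Con_lattice A\<^esub> \<Phi> = \<Theta> \<inter> \<Phi>"
proof -
  interpret lattice "Con_lattice A" by (rule lattice_Con_lattice)
  show ?thesis
    unfolding meet_def using inf_of_two_greatest[of \<Theta> \<Phi>] assms
    by (intro greatest_unique[OF _ greatest_Int_Con_lattice[OF assms]]) (simp add: carrier_Con_lattice)
qed

lemma join_Con_lattice:
  assumes "\<Theta> \<in> Con A" "\<Phi> \<in> Con A"
  shows "\<Theta> \<squnion>\<^bsub>Con_lattice A\<^esub> \<Phi> = (\<Theta> \<union> \<Phi>)\<^sup>+"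
proof -
  interpret lattice "Con_lattice A" by (rule lattice_Con_lattice)
  show ?thesis
    unfolding join_def using sup_of_two_least[of \<Theta> \<Phi>] assms
    by (intro least_unique[OF _ least_trancl_Un_Con_lattice[OF assms]]) (simp add: carrier_Con_lattice)
qed

section \<open>Congruence properties from terms\<close>

text \<open>
  Let \<open>(a, b)\<close> lie in \<open>\<Theta>\<close> and in the join of \<open>\<Phi>\<close> and \<open>\<Psi>\<close>, the latter by a chain
  \<open>a = c\<^sub>0, \<dots>, c\<^sub>n = b\<close> which may leave the \<open>\<Theta>\<close>-class of \<open>a\<close>. The chain with members
  \<open>m a c\<^sub>i b\<close> does not: each of these is \<open>\<Theta>\<close>-related to \<open>m a c\<^sub>i a = a\<close>. Its ends are still
  \<open>m a a b = a\<close> and \<open>m a b b = b\<close>.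
\<close>

lemma majority_term_imp_congruence_distributive:
  assumes comp: "\<And>\<Theta> a b c d e f. \<Theta> \<in> Con A \<Longrightarrow> (a, b) \<in> \<Theta> \<Longrightarrow> (c, d) \<in> \<Theta> \<Longrightarrow> (e, f) \<in> \<Theta> \<Longrightarrow>
      (m a c e, m b d f) \<in> \<Theta>"
    and maj: "\<And>x y. x \<in> carrier A \<Longrightarrow> y \<in> carrier A \<Longrightarrow> m x x y = x"
      "\<And>x y. x \<in> carrier A \<Longrightarrow> y \<in> carrier A \<Longrightarrow> m x y x = x"
      "\<And>x y. x \<in> carrier A \<Longrightarrow> y \<in> carrier A \<Longrightarrow> m x y y = y"
  shows "congruence_distributive A"
proof -
  have distrib: "\<Theta> \<inter> (\<Phi> \<union> \<Psi>)\<^sup>+ = ((\<Theta> \<inter> \<Phi>) \<union> (\<Theta> \<inter> \<Psi>))\<^sup>+"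
    if \<Theta>: "\<Theta> \<in> Con A" and \<Phi>: "\<Phi> \<in> Con A" and \<Psi>: "\<Psi> \<in> Con A" for \<Theta> \<Phi> \<Psi>
  proof
    show "((\<Theta> \<inter> \<Phi>) \<union> (\<Theta> \<inter> \<Psi>))\<^sup>+ \<subseteq> \<Theta> \<inter> (\<Phi> \<union> \<Psi>)\<^sup>+"
      by (intro trancl_Un_le_Con[OF Con_Int[OF \<Theta> Con_trancl_Un[OF \<Phi> \<Psi>]]]) auto
    show "\<Theta> \<inter> (\<Phi> \<union> \<Psi>)\<^sup>+ \<subseteq> ((\<Theta> \<inter> \<Phi>) \<union> (\<Theta> \<inter> \<Psi>))\<^sup>+"
    proof clarify
      fix a b
      assume ab: "(a, b) \<in> \<Theta>" and chain: "(a, b) \<in> (\<Phi> \<union> \<Psi>)\<^sup>+"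
      let ?J = "((\<Theta> \<inter> \<Phi>) \<union> (\<Theta> \<inter> \<Psi>))\<^sup>+"
      have a: "a \<in> carrier A" and b: "b \<in> carrier A"
        using Con_carrier[OF \<Theta> ab] by auto
      have class_a: "(m a c b, a) \<in> \<Theta>" if "c \<in> carrier A" for c
        using comp[OF \<Theta> Con_refl[OF \<Theta> a] Con_refl[OF \<Theta> that] Con_sym[OF \<Theta> ab]] maj(2)[OF a that]
        by simp
      have step: "(m a c b, m a d b) \<in> (\<Theta> \<inter> \<Phi>) \<union> (\<Theta> \<inter> \<Psi>)" if cd: "(c, d) \<in> \<Phi> \<union> \<Psi>" for c d
      proof -
        have "c \<in> carrier A" "d \<in> carrier A"
          using cd Con_carrier[OF \<Phi>] Con_carrier[OF \<Psi>] by auto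
        then have "(m a c b, m a d b) \<in> \<Theta>"
          by (intro Con_trans[OF \<Theta> class_a Con_sym[OF \<Theta> class_a]])
        moreover have "(m a c b, m a d b) \<in> \<Phi> \<union> \<Psi>"
          using cd comp[OF \<Phi>, OF Con_refl[OF \<Phi> a] _ Con_refl[OF \<Phi> b]]
            comp[OF \<Psi>, OF Con_refl[OF \<Psi> a] _ Con_refl[OF \<Psi> b]] by blast
        ultimately show ?thesis by blast
      qed
      have "(m a a b, m a b b) \<in> ?J"
        using chain step by (rule trancl_homomorphism)
      then show "(a, b) \<in> ?J"
        using maj(1)[OF a b] maj(3)[OF a b] by simp
    qed
  qed
  show ?thesis
    unfolding congruence_distributive_def distributive_lattice_def
  proof (intro conjI lattice_Con_lattice ballI)
    fix \<Theta> \<Phi> \<Psi>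
    assume "\<Theta> \<in> carrier (Con_lattice A)" "\<Phi> \<in> carrier (Con_lattice A)"
      "\<Psi> \<in> carrier (Con_lattice A)"
    then have "\<Theta> \<in> Con A" "\<Phi> \<in> Con A" "\<Psi> \<in> Con A"
      by (simp_all add: carrier_Con_lattice)
    then show "\<Theta> \<sqinter>\<^bsub>Con_lattice A\<^esub> (\<Phi> \<squnion>\<^bsub>Con_lattice A\<^esub> \<Psi>)
        = (\<Theta> \<sqinter>\<^bsub>Con_lattice A\<^esub> \<Phi>) \<squnion>\<^bsub>Con_lattice A\<^esub> (\<Theta> \<sqinter>\<^bsub>Con_lattice A\<^esub> \<Psi>)"
      by (simp add: meet_Con_lattice join_Con_lattice Con_Int Con_trancl_Un distrib)
  qed
qed

text \<open>
  If \<open>y\<close> witnesses that \<open>(x, z)\<close> lies in the product of \<open>\<Theta>\<close> with \<open>\<Phi>\<close>, then \<open>p x y z\<close>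
  is a witness for the reversed product: it is \<open>\<Phi>\<close>-related to \<open>p x y y = x\<close> and
  \<open>\<Theta>\<close>-related to \<open>p y y z = z\<close>.
\<close>

lemma Malcev_term_imp_congruence_permutable:
  assumes comp: "\<And>\<Theta> a b c d e f. \<Theta> \<in> Con A \<Longrightarrow> (a, b) \<in> \<Theta> \<Longrightarrow> (c, d) \<in> \<Theta> \<Longrightarrow> (e, f) \<in> \<Theta> \<Longrightarrow>
      (p a c e, p b d f) \<in> \<Theta>"
    and Malcev: "\<And>x z. x \<in> carrier A \<Longrightarrow> z \<in> carrier A \<Longrightarrow> p x x z = z"
      "\<And>x z. x \<in> carrier A \<Longrightarrow> z \<in> carrier A \<Longrightarrow> p x z z = x"
  shows "congruence_permutable A"
proof -
  have "\<Theta> O \<Phi> \<subseteq> \<Phi> O \<Theta>" if \<Theta>: "\<Theta> \<in> Con A" and \<Phi>: "\<Phi> \<in> Con A" for \<Theta> \<Phi>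
  proof clarify
    fix x y z
    assume xy: "(x, y) \<in> \<Theta>" and yz: "(y, z) \<in> \<Phi>"
    have x: "x \<in> carrier A" and y: "y \<in> carrier A" and z: "z \<in> carrier A"
      using Con_carrier[OF \<Theta> xy] Con_carrier[OF \<Phi> yz] by auto
    have "(x, p x y z) \<in> \<Phi>"
      using comp[OF \<Phi> Con_refl[OF \<Phi> x] Con_refl[OF \<Phi> y] yz] Malcev(2)[OF x y] by simp
    moreover have "(p x y z, z) \<in> \<Theta>"
      using comp[OF \<Theta> xy Con_refl[OF \<Theta> y] Con_refl[OF \<Theta> z]] Malcev(1)[OF y z] by simp
    ultimately show "(x, z) \<in> \<Phi> O \<Theta>" by blast
  qed
  then show ?thesis unfolding congruence_permutable_def by blast
qed

lemma weakly_regularI: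
  assumes detect: "\<And>\<Theta> x y. \<Theta> \<in> Con A \<Longrightarrow> x \<in> carrier A \<Longrightarrow> y \<in> carrier A \<Longrightarrow>
      (x, y) \<in> \<Theta> \<longleftrightarrow> (one, d x y) \<in> \<Theta> \<and> (one, e x y) \<in> \<Theta>"
  shows "weakly_regular A one"
  unfolding weakly_regular_def
proof (intro ballI impI)
  fix \<Theta> \<Phi>
  assume \<Theta>: "\<Theta> \<in> Con A" and \<Phi>: "\<Phi> \<in> Con A" and "\<Theta> `` {one} = \<Phi> `` {one}"
  then have "(one, u) \<in> \<Theta> \<longleftrightarrow> (one, u) \<in> \<Phi>" for u by blast
  then have "(x, y) \<in> \<Theta> \<longleftrightarrow> (x, y) \<in> \<Phi>" if "x \<in> carrier A" "y \<in> carrier A" for x y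
    using detect[OF \<Theta> that] detect[OF \<Phi> that] by simp
  then have "(x, y) \<in> \<Theta> \<longleftrightarrow> (x, y) \<in> \<Phi>" for x y
    using Con_carrier[OF \<Theta>] Con_carrier[OF \<Phi>] by metis
  then show "\<Theta> = \<Phi>" by auto
qed

section \<open>Operations assigned to a poset\<close>

lemma lambda_lattice_imp_commutative_meet_directoid:
  "lambda_lattice P cup cap \<Longrightarrow> commutative_meet_directoid P cap"
  by (simp add: lambda_lattice_def commutative_meet_directoid_def)

lemma commutative_meet_directoidD:
  assumes "commutative_meet_directoid P cap" "x \<in> carrier P" "y \<in> carrier P"
  shows "cap x y \<in> carrier P" "cap x y = cap y x"
    "cap x y \<in> Lower P {x, y}" "x \<sqsubseteq>\<^bsub>P\<^esub> y \<Longrightarrow> cap x y = x" "y \<sqsubseteq>\<^bsub>P\<^esub> x \<Longrightarrow> cap x y = y"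
  using assms Lower_closed[of P "{x, y}"] unfolding commutative_meet_directoid_def by blast+

lemma lambda_lattice_joinD:
  assumes "lambda_lattice P cup cap" "x \<in> carrier P" "y \<in> carrier P"
  shows "cup x y \<in> carrier P" "x \<sqsubseteq>\<^bsub>P\<^esub> cup x y" "y \<sqsubseteq>\<^bsub>P\<^esub> cup x y"
    "x \<sqsubseteq>\<^bsub>P\<^esub> y \<Longrightarrow> cup x y = y" "y \<sqsubseteq>\<^bsub>P\<^esub> x \<Longrightarrow> cup x y = x"
  using assms unfolding lambda_lattice_def Upper_def by blast+

lemma lambda_lattice_absorption:
  assumes "lambda_lattice P cup cap" and x: "x \<in> carrier P" and y: "y \<in> carrier P"
  shows "cup x (cap x y) = x" "cup x (cap y x) = x" "cup (cap x y) x = x" "cup (cap y x) x = x"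
proof -
  note dir = commutative_meet_directoidD[OF lambda_lattice_imp_commutative_meet_directoid[OF assms(1)]]
  have "cap x y \<sqsubseteq>\<^bsub>P\<^esub> x" "cap y x = cap x y"
    using dir(2,3)[OF x y] x y by (auto simp: Lower_def)
  then show "cup x (cap x y) = x" "cup x (cap y x) = x" "cup (cap x y) x = x" "cup (cap y x) x = x"
    using lambda_lattice_joinD(4,5)[OF assms(1)] dir(1)[OF x y] x by simp_all
qed

text \<open>
  In the median term \<open>((x \<sqinter> y) \<squnion> (y \<sqinter> z)) \<squnion> (z \<sqinter> x)\<close>, two equal arguments leave one meet equal
  to their common value, and absorption removes the two others.
\<close>

lemma lambda_lattice_imp_congruence_distributive:
  assumes po: "partial_order P" and L: "lambda_lattice P cup cap"
    and carr: "carrier A = carrier P"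
    and ops: "Binary cup \<in> operations A" "Binary cap \<in> operations A"
  shows "congruence_distributive A"
proof -
  note dir = commutative_meet_directoidD[OF lambda_lattice_imp_commutative_meet_directoid[OF L]]
  note absorb = lambda_lattice_absorption[OF L]
  interpret partial_order P by (rule po)
  have idem: "cap x x = x" "cup x x = x" if "x \<in> carrier P" for x
    using dir(4)[OF that that le_refl[OF that]] lambda_lattice_joinD(4)[OF L that that le_refl[OF that]]
    by simp_all
  show ?thesis
  proof (rule majority_term_imp_congruence_distributive
      [where m = "\<lambda>x y z. cup (cup (cap x y) (cap y z)) (cap z x)"])
    fix \<Theta> a b c d e f
    assume \<Theta>: "\<Theta> \<in> Con A" and "(a, b) \<in> \<Theta>" "(c, d) \<in> \<Theta>" "(e, f) \<in> \<Theta>"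
    then show "(cup (cup (cap a c) (cap c e)) (cap e a), cup (cup (cap b d) (cap d f)) (cap f b)) \<in> \<Theta>"
      by (intro Con_Binary[OF \<Theta> ops(1)] Con_Binary[OF \<Theta> ops(2)])
  next
    fix x y
    assume "x \<in> carrier A" "y \<in> carrier A"
    then have x: "x \<in> carrier P" and y: "y \<in> carrier P" using carr by auto
    show "cup (cup (cap x x) (cap x y)) (cap y x) = x"
      using idem x y absorb by simp
    show "cup (cup (cap x y) (cap y x)) (cap x x) = x"
      using idem dir(1,2)[OF x y] x y absorb by simp
    show "cup (cup (cap x y) (cap y y)) (cap y x) = y"
      using idem x y absorb by simp
  qed
qed

text \<open>
  The laws assumed of \<open>imp\<close> are those shared by relative pseudocomplements and strong
  sectional pseudocomplements.
\<close>

lemma implication_imp_congruence_permutable: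
  assumes D: "commutative_meet_directoid P cap" and one: "one \<in> carrier P"
    and closed: "\<And>x y. x \<in> carrier P \<Longrightarrow> y \<in> carrier P \<Longrightarrow> imp x y \<in> carrier P"
    and self: "\<And>x. x \<in> carrier P \<Longrightarrow> imp x x = one"
    and unit: "\<And>x. x \<in> carrier P \<Longrightarrow> imp one x = x"
    and double: "\<And>x y. x \<in> carrier P \<Longrightarrow> y \<in> carrier P \<Longrightarrow> x \<sqsubseteq>\<^bsub>P\<^esub> imp (imp x y) y"
    and carr: "carrier A = carrier P"
    and ops: "Binary cap \<in> operations A" "Binary imp \<in> operations A"
  shows "congruence_permutable A"
proof (rule Malcev_term_imp_congruence_permutable
    [where p = "\<lambda>x y z. cap (imp (imp x y) z) (imp (imp z y) x)"])
  fix \<Theta> a b c d e f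
  assume \<Theta>: "\<Theta> \<in> Con A" and "(a, b) \<in> \<Theta>" "(c, d) \<in> \<Theta>" "(e, f) \<in> \<Theta>"
  then show "(cap (imp (imp a c) e) (imp (imp e c) a), cap (imp (imp b d) f) (imp (imp f d) b)) \<in> \<Theta>"
    by (intro Con_Binary[OF \<Theta> ops(1)] Con_Binary[OF \<Theta> ops(2)])
next
  fix x z
  assume "x \<in> carrier A" "z \<in> carrier A"
  then have x: "x \<in> carrier P" and z: "z \<in> carrier P" using carr by auto
  show "cap (imp (imp x x) z) (imp (imp z x) x) = z"
    using commutative_meet_directoidD(4)[OF D z _ double[OF z x]] x z closed self unit by simp
  show "cap (imp (imp x z) z) (imp (imp z z) x) = x"
    using commutative_meet_directoidD(5)[OF D _ x double[OF x z]] x z closed self unit by simp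
qed

section \<open>Relative pseudocomplementation\<close>

lemma relatively_pseudocomplementedD:
  assumes R: "relatively_pseudocomplemented_poset P rpc one"
  shows "partial_order P" "one \<in> carrier P"
    and "x \<in> carrier P \<Longrightarrow> y \<in> carrier P \<Longrightarrow> rpc x y \<in> carrier P"
    and "x \<in> carrier P \<Longrightarrow> rpc x x = one"
    and "x \<in> carrier P \<Longrightarrow> rpc one x = x"
    and "x \<in> carrier P \<Longrightarrow> y \<in> carrier P \<Longrightarrow> x \<sqsubseteq>\<^bsub>P\<^esub> rpc (rpc x y) y"
proof -
  show "partial_order P" using R by (simp add: relatively_pseudocomplemented_poset_def)
  then interpret partial_order P .
  have top: "one \<in> carrier P" "z \<in> carrier P \<Longrightarrow> z \<sqsubseteq>\<^bsub>P\<^esub> one" for z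
    using R by (auto simp: relatively_pseudocomplemented_poset_def greatest_def)
  have gr: "rpc x y \<in> carrier P" "Lower P {x, rpc x y} \<subseteq> Lower P {y}"
    "z \<in> carrier P \<Longrightarrow> Lower P {x, z} \<subseteq> Lower P {y} \<Longrightarrow> z \<sqsubseteq>\<^bsub>P\<^esub> rpc x y"
    if "x \<in> carrier P" "y \<in> carrier P" for x y z
    using R that by (auto simp: relatively_pseudocomplemented_poset_def greatest_def)
  show "one \<in> carrier P" by (rule top)
  show "rpc x y \<in> carrier P" if "x \<in> carrier P" "y \<in> carrier P"
    using gr that by blast
  show "rpc x x = one" if x: "x \<in> carrier P"
  proof (rule le_antisym)
    have "Lower P {x, one} \<subseteq> Lower P {x}" by (auto simp: Lower_def)
    then show "one \<sqsubseteq>\<^bsub>P\<^esub> rpc x x" using gr(3)[OF x x] top by blast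
  qed (use top gr(1)[OF x x] in auto)
  show "rpc one x = x" if x: "x \<in> carrier P"
  proof (rule le_antisym)
    have "rpc one x \<in> Lower P {one, rpc one x}"
      using top gr(1)[OF top(1) x] by (auto simp: Lower_def)
    then show "rpc one x \<sqsubseteq>\<^bsub>P\<^esub> x"
      using gr(2)[OF top(1) x] x by (auto simp: Lower_def)
    have "Lower P {one, x} \<subseteq> Lower P {x}" by (auto simp: Lower_def)
    then show "x \<sqsubseteq>\<^bsub>P\<^esub> rpc one x" using gr(3)[OF top(1) x] x by blast
  qed (use x gr(1)[OF top(1) x] in auto)
  show "x \<sqsubseteq>\<^bsub>P\<^esub> rpc (rpc x y) y" if x: "x \<in> carrier P" and y: "y \<in> carrier P"
    using gr(2)[OF x y] gr(3)[OF gr(1)[OF x y] y x] by (simp add: insert_commute)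
qed

text \<open>
  If \<open>u * v\<close> is congruent to \<open>1\<close>, then \<open>u = u \<sqinter> ((u * v) * v)\<close> is congruent to
  \<open>u \<sqinter> (1 * v) = u \<sqinter> v\<close>. Applied in both directions and with commutativity of \<open>\<sqinter>\<close>, this
  joins \<open>x\<close> to \<open>y\<close> through \<open>x \<sqinter> y\<close>.
\<close>

lemma relatively_pseudocomplemented_imp_weakly_regular:
  assumes R: "relatively_pseudocomplemented_poset P rpc one"
    and D: "commutative_meet_directoid P cap"
    and carr: "carrier A = carrier P"
    and ops: "Binary cap \<in> operations A" "Binary rpc \<in> operations A"
  shows "weakly_regular A one"
proof (rule weakly_regularI[where d = rpc and e = "\<lambda>x y. rpc y x"])
  fix \<Theta> x y
  assume \<Theta>: "\<Theta> \<in> Con A" and "x \<in> carrier A" "y \<in> carrier A"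
  then have x: "x \<in> carrier P" and y: "y \<in> carrier P" using carr by auto
  note rpc = relatively_pseudocomplementedD[OF R]
  have refl: "(z, z) \<in> \<Theta>" if "z \<in> carrier P" for z
    using Con_refl[OF \<Theta>] that carr by simp
  have below: "(cap u v, u) \<in> \<Theta>"
    if "(one, rpc u v) \<in> \<Theta>" and u: "u \<in> carrier P" and v: "v \<in> carrier P" for u v
  proof -
    have "(cap u (rpc one v), cap u (rpc (rpc u v) v)) \<in> \<Theta>"
      using that refl by (intro Con_Binary[OF \<Theta> ops(1)] Con_Binary[OF \<Theta> ops(2)])
    moreover have "cap u (rpc (rpc u v) v) = u"
      using commutative_meet_directoidD(4)[OF D u _ rpc(6)[OF u v]] rpc(3) u v by simp
    ultimately show ?thesis using rpc(5)[OF v] by simp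
  qed
  show "(x, y) \<in> \<Theta> \<longleftrightarrow> (one, rpc x y) \<in> \<Theta> \<and> (one, rpc y x) \<in> \<Theta>"
  proof
    assume xy: "(x, y) \<in> \<Theta>"
    show "(one, rpc x y) \<in> \<Theta> \<and> (one, rpc y x) \<in> \<Theta>"
      using Con_Binary[OF \<Theta> ops(2) refl[OF x] xy]
        Con_Binary[OF \<Theta> ops(2) refl[OF y] Con_sym[OF \<Theta> xy]] rpc(4)[OF x] rpc(4)[OF y] by simp
  next
    assume "(one, rpc x y) \<in> \<Theta> \<and> (one, rpc y x) \<in> \<Theta>"
    then have "(cap x y, x) \<in> \<Theta>" "(cap x y, y) \<in> \<Theta>"
      using below[OF _ x y] below[OF _ y x] commutative_meet_directoidD(2)[OF D x y] by auto
    then show "(x, y) \<in> \<Theta>" using Con_sym[OF \<Theta>] Con_trans[OF \<Theta>] by blast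
  qed
qed

section \<open>Sectional pseudocomplementation\<close>

lemma sectionally_pseudocomplemented_with_oneD:
  assumes S: "sectionally_pseudocomplemented_poset_with_one P spc one"
  shows "partial_order P" "one \<in> carrier P" "x \<in> carrier P \<Longrightarrow> x \<sqsubseteq>\<^bsub>P\<^esub> one"
    and "x \<in> carrier P \<Longrightarrow> y \<in> carrier P \<Longrightarrow> spc x y \<in> carrier P"
    and "x \<in> carrier P \<Longrightarrow> spc x x = one"
    and "x \<in> carrier P \<Longrightarrow> spc one x = x"
    and "x \<in> carrier P \<Longrightarrow> y \<in> carrier P \<Longrightarrow> y \<sqsubseteq>\<^bsub>P\<^esub> x \<Longrightarrow> Lower P {x, spc x y} = Lower P {y}"
proof -
  show po: "partial_order P"
    using S by (simp add: sectionally_pseudocomplemented_poset_with_one_def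
        sectionally_pseudocomplemented_poset_def)
  then interpret partial_order P .
  have top: "one \<in> carrier P" "z \<in> carrier P \<Longrightarrow> z \<sqsubseteq>\<^bsub>P\<^esub> one" for z
    using S by (auto simp: sectionally_pseudocomplemented_poset_with_one_def greatest_def)
  have gr: "spc x y \<in> carrier P" "Lower P (Upper P {x, y} \<union> {spc x y}) = Lower P {y}"
    "z \<in> carrier P \<Longrightarrow> Lower P (Upper P {x, y} \<union> {z}) = Lower P {y} \<Longrightarrow> z \<sqsubseteq>\<^bsub>P\<^esub> spc x y"
    if "x \<in> carrier P" "y \<in> carrier P" for x y z
    using S that by (auto simp: sectionally_pseudocomplemented_poset_with_one_def
        sectionally_pseudocomplemented_poset_def greatest_def)
  \<comment> \<open>In the section above \<open>y\<close> the cone condition involves lower bounds of two elements only,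
    since \<open>x\<close> is then the least element of \<open>U(x, y)\<close>.\<close>
  have cone: "Lower P (Upper P {x, y} \<union> {z}) = Lower P {x, z}"
    if x: "x \<in> carrier P" and y: "y \<in> carrier P" and yx: "y \<sqsubseteq>\<^bsub>P\<^esub> x" for x y z
  proof
    show "Lower P (Upper P {x, y} \<union> {z}) \<subseteq> Lower P {x, z}"
      using x yx by (intro Lower_antimono) (auto simp: Upper_def)
    show "Lower P {x, z} \<subseteq> Lower P (Upper P {x, y} \<union> {z})"
      using x by (auto simp: Lower_def Upper_def intro: le_trans)
  qed
  show "one \<in> carrier P" "x \<in> carrier P \<Longrightarrow> x \<sqsubseteq>\<^bsub>P\<^esub> one" using top by auto
  show "spc x y \<in> carrier P" if "x \<in> carrier P" "y \<in> carrier P"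
    using gr that by blast
  show in_section: "Lower P {x, spc x y} = Lower P {y}"
    if "x \<in> carrier P" "y \<in> carrier P" "y \<sqsubseteq>\<^bsub>P\<^esub> x" for x y
    using gr(2)[OF that(1,2)] cone[OF that, of "spc x y"] by simp
  show "spc x x = one" if x: "x \<in> carrier P"
  proof (rule le_antisym)
    have "Lower P {x, one} = Lower P {x}" using top by (auto simp: Lower_def)
    then show "one \<sqsubseteq>\<^bsub>P\<^esub> spc x x" using gr(3)[OF x x top(1)] cone[OF x x] x by simp
  qed (use top gr(1)[OF x x] in auto)
  show "spc one x = x" if x: "x \<in> carrier P"
  proof (rule le_antisym)
    have low: "Lower P {one, z} = Lower P {z}" for z
      using top by (auto simp: Lower_def)
    then have "spc one x \<in> Lower P {x}"
      using in_section[OF top(1) x top(2)[OF x]] gr(1)[OF top(1) x] by (auto simp: Lower_def)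
    then show "spc one x \<sqsubseteq>\<^bsub>P\<^esub> x" using x by (auto simp: Lower_def)
    show "x \<sqsubseteq>\<^bsub>P\<^esub> spc one x"
      using gr(3)[OF top(1) x x] cone[OF top(1) x top(2)[OF x]] low by simp
  qed (use x gr(1)[OF top(1) x] in auto)
qed

text \<open>
  The key is the identity \<open>((w \<circ> v) \<sqinter> w) \<squnion> v = v\<close> for \<open>v \<sqsubseteq> w\<close>: the meet may be any common lower
  bound of \<open>w \<circ> v\<close> and \<open>w\<close>, but all of these are below \<open>v\<close>. Replacing \<open>w \<circ> v\<close> by \<open>1\<close>
  turns the left side into \<open>w\<close>. Thus \<open>w\<close> and \<open>v\<close> are congruent whenever \<open>w \<circ> v\<close> and \<open>1\<close> are,
  which is applied to \<open>w = x \<squnion> y\<close> and \<open>v \<in> {x, y}\<close>.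
\<close>

lemma sectionally_pseudocomplemented_imp_weakly_regular:
  assumes S: "sectionally_pseudocomplemented_poset_with_one P spc one"
    and L: "lambda_lattice P cup cap"
    and carr: "carrier A = carrier P"
    and ops: "Binary cup \<in> operations A" "Binary cap \<in> operations A" "Binary spc \<in> operations A"
  shows "weakly_regular A one"
proof (rule weakly_regularI[where d = "\<lambda>x y. spc (cup x y) y" and e = "\<lambda>x y. spc (cup x y) x"])
  fix \<Theta> x y
  assume \<Theta>: "\<Theta> \<in> Con A" and "x \<in> carrier A" "y \<in> carrier A"
  then have x: "x \<in> carrier P" and y: "y \<in> carrier P" using carr by auto
  note spc = sectionally_pseudocomplemented_with_oneD[OF S]
  note dir = commutative_meet_directoidD[OF lambda_lattice_imp_commutative_meet_directoid[OF L]]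
  note join = lambda_lattice_joinD[OF L]
  interpret partial_order P by (rule spc(1))
  have refl: "(z, z) \<in> \<Theta>" if "z \<in> carrier P" for z
    using Con_refl[OF \<Theta>] that carr by simp
  have collapse: "(w, v) \<in> \<Theta>"
    if one_w: "(one, spc w v) \<in> \<Theta>" and w: "w \<in> carrier P" and v: "v \<in> carrier P" and vw: "v \<sqsubseteq>\<^bsub>P\<^esub> w"
    for w v
  proof -
    have "(cup (cap one w) v, cup (cap (spc w v) w) v) \<in> \<Theta>"
      using one_w refl w v by (intro Con_Binary[OF \<Theta> ops(1)] Con_Binary[OF \<Theta> ops(2)])
    moreover have "cup (cap one w) v = w"
      using dir(5)[OF spc(2) w spc(3)[OF w]] join(5)[OF w v vw] by simp
    moreover have "cup (cap (spc w v) w) v = v"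
    proof -
      have "cap (spc w v) w \<in> Lower P {v}"
        using dir(3)[OF spc(4)[OF w v] w] spc(7)[OF w v vw] by (simp add: insert_commute)
      then show ?thesis
        using join(4) dir(1)[OF spc(4)[OF w v] w] v by (auto simp: Lower_def)
    qed
    ultimately show ?thesis by simp
  qed
  have w: "cup x y \<in> carrier P" "x \<sqsubseteq>\<^bsub>P\<^esub> cup x y" "y \<sqsubseteq>\<^bsub>P\<^esub> cup x y"
    using join[OF x y] by auto
  show "(x, y) \<in> \<Theta> \<longleftrightarrow> (one, spc (cup x y) y) \<in> \<Theta> \<and> (one, spc (cup x y) x) \<in> \<Theta>"
  proof
    assume xy: "(x, y) \<in> \<Theta>"
    have "(cup y y, cup x y) \<in> \<Theta>" "(cup x x, cup x y) \<in> \<Theta>"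
      using Con_Binary[OF \<Theta> ops(1)] Con_sym[OF \<Theta> xy] xy refl x y by blast+
    then have "(y, cup x y) \<in> \<Theta>" "(x, cup x y) \<in> \<Theta>"
      using join(4)[OF x x] join(4)[OF y y] x y by simp_all
    then have "(spc y y, spc (cup x y) y) \<in> \<Theta>" "(spc x x, spc (cup x y) x) \<in> \<Theta>"
      using Con_Binary[OF \<Theta> ops(3)] refl x y by blast+
    then show "(one, spc (cup x y) y) \<in> \<Theta> \<and> (one, spc (cup x y) x) \<in> \<Theta>"
      using spc(5) x y by simp
  next
    assume "(one, spc (cup x y) y) \<in> \<Theta> \<and> (one, spc (cup x y) x) \<in> \<Theta>"
    then have "(cup x y, y) \<in> \<Theta>" "(cup x y, x) \<in> \<Theta>"
      using collapse w x y by blast+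
    then show "(x, y) \<in> \<Theta>" using Con_sym[OF \<Theta>] Con_trans[OF \<Theta>] by blast
  qed
qed

section \<open>Congruence properties of the assigned algebras\<close>

theorem theorem6p1:
  shows
    "(\<forall>(P :: 'a gorder) star zero cup cap.
        stone_poset P star zero \<and> lambda_lattice P cup cap \<longrightarrow>
        congruence_distributive
          \<lparr>carrier = carrier P,
           operations = {Binary cup, Binary cap, Unary star, Nullary zero}\<rparr>) \<and>
     (\<forall>(P :: 'a gorder) rpc one cap.
        relatively_pseudocomplemented_poset P rpc one \<and> down_directed P \<and>
        commutative_meet_directoid P cap \<longrightarrow>
        (let A = \<lparr>carrier = carrier P,
                  operations = {Binary cap, Binary rpc, Nullary one}\<rparr>
         in congruence_permutable A \<and> weakly_regular A one)) \<and>
     (\<forall>(P :: 'a gorder) spc cup cap.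
        sectionally_pseudocomplemented_poset P spc \<and> directed P \<and>
        lambda_lattice P cup cap \<longrightarrow>
        congruence_distributive
          \<lparr>carrier = carrier P,
           operations = {Binary cup, Binary cap, Binary spc}\<rparr>) \<and>
     (\<forall>(P :: 'a gorder) spc one cup cap.
        sectionally_pseudocomplemented_poset_with_one P spc one \<and> down_directed P \<and>
        lambda_lattice P cup cap \<longrightarrow>
        (let A = \<lparr>carrier = carrier P,
                  operations = {Binary cup, Binary cap, Binary spc, Nullary one}\<rparr>
         in congruence_distributive A \<and> weakly_regular A one)) \<and>
     (\<forall>(P :: 'a gorder) spc one cup cap.
        strongly_sectionally_pseudocomplemented_poset P spc one \<and> down_directed P \<and>
        lambda_lattice P cup cap \<longrightarrow>
        (let A = \<lparr>carrier = carrier P,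
                  operations = {Binary cup, Binary cap, Binary spc, Nullary one}\<rparr>
         in arithmetical A \<and> weakly_regular A one))"
proof (intro conjI allI impI; (elim conjE)?)
  fix P :: "'a gorder" and star zero cup cap
  assume "stone_poset P star zero" "lambda_lattice P cup cap"
  then show "congruence_distributive
      \<lparr>carrier = carrier P, operations = {Binary cup, Binary cap, Unary star, Nullary zero}\<rparr>"
    by (intro lambda_lattice_imp_congruence_distributive[of P cup cap])
      (auto simp: stone_poset_def pseudocomplemented_poset_def)
next
  fix P :: "'a gorder" and rpc one cap
  assume R: "relatively_pseudocomplemented_poset P rpc one"
    and D: "commutative_meet_directoid P cap"
  note rpc = relatively_pseudocomplementedD[OF R]
  show "let A = \<lparr>carrier = carrier P, operations = {Binary cap, Binary rpc, Nullary one}\<rparr>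
      in congruence_permutable A \<and> weakly_regular A one"
    unfolding Let_def
  proof
    show "congruence_permutable
        \<lparr>carrier = carrier P, operations = {Binary cap, Binary rpc, Nullary one}\<rparr>"
      by (rule implication_imp_congruence_permutable[OF D rpc(2), where imp = rpc]) (simp_all add: rpc)
    show "weakly_regular
        \<lparr>carrier = carrier P, operations = {Binary cap, Binary rpc, Nullary one}\<rparr> one"
      by (rule relatively_pseudocomplemented_imp_weakly_regular[OF R D]) simp_all
  qed
next
  fix P :: "'a gorder" and spc cup cap
  assume "sectionally_pseudocomplemented_poset P spc" "lambda_lattice P cup cap"
  then show "congruence_distributive
      \<lparr>carrier = carrier P, operations = {Binary cup, Binary cap, Binary spc}\<rparr>"
    by (intro lambda_lattice_imp_congruence_distributive[of P cup cap])
      (auto simp: sectionally_pseudocomplemented_poset_def)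
next
  fix P :: "'a gorder" and spc one cup cap
  assume S: "sectionally_pseudocomplemented_poset_with_one P spc one"
    and L: "lambda_lattice P cup cap"
  let ?A = "\<lparr>carrier = carrier P,
    operations = {Binary cup, Binary cap, Binary spc, Nullary one}\<rparr>"
  have "congruence_distributive ?A"
    by (rule lambda_lattice_imp_congruence_distributive[OF sectionally_pseudocomplemented_with_oneD(1)[OF S] L]) simp_all
  moreover have "weakly_regular ?A one"
    by (rule sectionally_pseudocomplemented_imp_weakly_regular[OF S L]) simp_all
  ultimately show "let A = ?A in congruence_distributive A \<and> weakly_regular A one"
    by (simp add: Let_def)
next
  fix P :: "'a gorder" and spc one cup cap
  assume strong: "strongly_sectionally_pseudocomplemented_poset P spc one"
    and L: "lambda_lattice P cup cap"
  let ?A = "\<lparr>carrier = carrier P,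
    operations = {Binary cup, Binary cap, Binary spc, Nullary one}\<rparr>"
  have S: "sectionally_pseudocomplemented_poset_with_one P spc one"
    using strong by (simp add: strongly_sectionally_pseudocomplemented_poset_def)
  have double: "x \<sqsubseteq>\<^bsub>P\<^esub> spc (spc x y) y" if "x \<in> carrier P" "y \<in> carrier P" for x y
    using strong that by (simp add: strongly_sectionally_pseudocomplemented_poset_def)
  note spc = sectionally_pseudocomplemented_with_oneD[OF S]
  have "congruence_distributive ?A"
    by (rule lambda_lattice_imp_congruence_distributive[OF spc(1) L]) simp_all
  moreover have "congruence_permutable ?A"
    by (rule implication_imp_congruence_permutable
        [OF lambda_lattice_imp_commutative_meet_directoid[OF L] spc(2), where imp = spc])
      (simp_all add: spc double)
  moreover have "weakly_regular ?A one"
    by (rule sectionally_pseudocomplemented_imp_weakly_regular[OF S L]) simp_all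
  ultimately show "let A = ?A in arithmetical A \<and> weakly_regular A one"
    by (simp add: Let_def arithmetical_def)
qed

end
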